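(* Let $\widehat{A}=A+\epsilon B\in\mathbb{DR}^{n\times n}$ with $\operatorname{Ind}(A)=m$, and write $\widehat{A}^{m}=A^{m}+\epsilon S$, where $S=\sum_{i=1}^{m}A^{m-i}BA^{i-1}$. If the dual Moore-Penrose inverse $(\widehat{A}^{m})^{\dagger}$ exists and $(\widehat{A}^{m})^{\dagger}=(A^{m})^{\dagger}-\epsilon(A^{m})^{\dagger}S(A^{m})^{\dagger}$, then the dual core-EP generalized inverse $\widehat{A}^{\dagger_c}$ exists and $\widehat{A}^{\dagger_c}=A^{\dagger_c}-\epsilon A^{\dagger_c}BA^{\dagger_c}$.
   Context: Dual numbers are $a+\epsilon b$ with $a,b\in\mathbb{R}$, $\epsilon\neq 0$, $\epsilon^2=0$. $\mathbb{DR}^{n\times n}$ is the set of dual real matrices $\widehat{A}=A+\epsilon B$, $A,B\in\mathbb{R}^{n\times n}$, with product $(A+\epsilon B)(C+\epsilon D)=AC+\epsilon(AD+BC)$ and transpose $(A+\epsilon B)^T=A^T+\epsilon B^T$. $\operatorname{Ind}(A)$ is the smallest nonnegative integer $s$ with $\operatorname{rank}(A^{s+1})=\operatorname{rank}(A^s)$. For real matrices $^{\dagger}$ is the Moore-Penrose inverse; for real square $A$ of index $m$, $A^{\dagger_c}$ is the core-EP inverse, the unique real $X$ with $(AX)^T=AX$, $AX^2=X$, $XA^{m+1}=A^m$. For a dual matrix $\widehat{C}$, the dual Moore-Penrose inverse $\widehat{C}^{\dagger}$ is the $\widehat{X}$ (unique if it exists) with $\widehat{C}\widehat{X}\widehat{C}=\widehat{C}$,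 $\widehat{X}\widehat{C}\widehat{X}=\widehat{X}$, $(\widehat{C}\widehat{X})^T=\widehat{C}\widehat{X}$, $(\widehat{X}\widehat{C})^T=\widehat{X}\widehat{C}$. For $\widehat{A}=A+\epsilon B$ with $\operatorname{Ind}(A)=m$, the dual core-EP generalized inverse $\widehat{A}^{\dagger_c}$ is the $\widehat{X}\in\mathbb{DR}^{n\times n}$ (unique if it exists) with $(\widehat{A}\widehat{X})^{T}=\widehat{A}\widehat{X}$, $\widehat{A}\widehat{X}^{2}=\widehat{X}$, $\widehat{X}\widehat{A}^{m+1}=\widehat{A}^{m}$. *)

theory Defs
  imports "HOL-Analysis.Analysis"
begin

section \<open>Real square matrices\<close>

text \<open>The library's \<open>^\<close> and \<open>*\<close> on \<open>real ^ 'n ^ 'n\<close> are componentwise, hence a separate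
  power with respect to the matrix product.\<close>

primrec mpow :: "real ^ 'n ^ 'n \<Rightarrow> nat \<Rightarrow> real ^ 'n ^ 'n" where
  "mpow A 0 = mat 1"
| "mpow A (Suc k) = A ** mpow A k"

definition mat_index :: "real ^ 'n ^ 'n \<Rightarrow> nat" where
  "mat_index A = (LEAST s. rank (mpow A (s + 1)) = rank (mpow A s))"

definition is_mp_inverse :: "real ^ 'n ^ 'n \<Rightarrow> real ^ 'n ^ 'n \<Rightarrow> bool" where
  "is_mp_inverse A X \<longleftrightarrow>
     A ** X ** A = A \<and> X ** A ** X = X \<and>
     transpose (A ** X) = A ** X \<and> transpose (X ** A) = X ** A"

definition mp_inverse :: "real ^ 'n ^ 'n \<Rightarrow> real ^ 'n ^ 'n" where
  "mp_inverse A = (THE X. is_mp_inverse A X)"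

definition is_core_ep_inverse :: "real ^ 'n ^ 'n \<Rightarrow> real ^ 'n ^ 'n \<Rightarrow> bool" where
  "is_core_ep_inverse A X \<longleftrightarrow>
     transpose (A ** X) = A ** X \<and>
     A ** mpow X 2 = X \<and>
     X ** mpow A (mat_index A + 1) = mpow A (mat_index A)"

definition core_ep_inverse :: "real ^ 'n ^ 'n \<Rightarrow> real ^ 'n ^ 'n" where
  "core_ep_inverse A = (THE X. is_core_ep_inverse A X)"

section \<open>Dual real square matrices\<close>

text \<open>\<open>Dual A B\<close> stands for \<open>A + \<epsilon> B\<close> with \<open>\<epsilon>\<^sup>2 = 0\<close>.\<close>

datatype 'n dual_matrix = Dual (std_part: "real ^ 'n ^ 'n") (inf_part: "real ^ 'n ^ 'n")

lemma matrix_add_rdistrib': "(A + B) ** C = A ** C + B ** (C :: real ^ 'n ^ 'n)"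
  by (simp add: matrix_matrix_mult_def vec_eq_iff distrib_right sum.distrib)

instantiation dual_matrix :: (finite) monoid_mult
begin

definition one_dual_matrix :: "'a dual_matrix" where
  "1 = Dual (mat 1) 0"

definition times_dual_matrix :: "'a dual_matrix \<Rightarrow> 'a dual_matrix \<Rightarrow> 'a dual_matrix" where
  "X * Y = Dual (std_part X ** std_part Y)
                (std_part X ** inf_part Y + inf_part X ** std_part Y)"

instance
  by standard
    (simp_all add: one_dual_matrix_def times_dual_matrix_def matrix_mul_assoc
      matrix_add_ldistrib matrix_add_rdistrib' add.assoc)

end

definition dual_transpose :: "'n::finite dual_matrix \<Rightarrow> 'n dual_matrix" where
  "dual_transpose X = Dual (transpose (std_part X)) (transpose (inf_part X))"

definition is_dual_mp_inverse :: "'n::finite dual_matrix \<Rightarrow> 'n dual_matrix \<Rightarrow> bool" where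
  "is_dual_mp_inverse C X \<longleftrightarrow>
     C * X * C = C \<and> X * C * X = X \<and>
     dual_transpose (C * X) = C * X \<and> dual_transpose (X * C) = X * C"

definition dual_mp_inverse_exists :: "'n::finite dual_matrix \<Rightarrow> bool" where
  "dual_mp_inverse_exists C \<longleftrightarrow> (\<exists>X. is_dual_mp_inverse C X)"

definition dual_mp_inverse :: "'n::finite dual_matrix \<Rightarrow> 'n dual_matrix" where
  "dual_mp_inverse C = (THE X. is_dual_mp_inverse C X)"

definition is_dual_core_ep_inverse :: "'n::finite dual_matrix \<Rightarrow> 'n dual_matrix \<Rightarrow> bool" where
  "is_dual_core_ep_inverse A X \<longleftrightarrow>
     (let m = mat_index (std_part A) in
       dual_transpose (A * X) = A * X \<and>
       A * X ^ 2 = X \<and>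
       X * A ^ (m + 1) = A ^ m)"

definition dual_core_ep_inverse_exists :: "'n::finite dual_matrix \<Rightarrow> bool" where
  "dual_core_ep_inverse_exists A \<longleftrightarrow> (\<exists>X. is_dual_core_ep_inverse A X)"

definition dual_core_ep_inverse :: "'n::finite dual_matrix \<Rightarrow> 'n dual_matrix" where
  "dual_core_ep_inverse A = (THE X. is_dual_core_ep_inverse A X)"

lemma matrix_mult_sum_right: "A ** (\<Sum>i\<in>I. f i) = (\<Sum>i\<in>I. A ** (f i :: real ^ 'n ^ 'n))"
  by (induction I rule: infinite_finite_induct)
    (simp_all add: matrix_add_ldistrib)

lemma dual_matrix_power:
  "Dual A B ^ m = Dual (mpow A m) (\<Sum>i = 1..m. mpow A (m - i) ** B ** mpow A (i - 1))"
proof (induction m)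
  case 0
  show ?case by (simp add: one_dual_matrix_def)
next
  case (Suc m)
  have "A ** (\<Sum>i = 1..m. mpow A (m - i) ** B ** mpow A (i - 1)) =
        (\<Sum>i = 1..m. mpow A (Suc m - i) ** B ** mpow A (i - 1))"
    unfolding matrix_mult_sum_right
    by (rule sum.cong) (simp_all add: matrix_mul_assoc Suc_diff_le)
  then show ?case
    by (simp add: Suc times_dual_matrix_def)
qed

end

theory Submission
  imports Defs
begin

text \<open>
  Write \<open>P = A\<^sup>m\<close>, let \<open>Y\<close> be its Moore-Penrose inverse, and let \<open>Q = P Y\<close> be the orthogonal
  projector onto the range of \<open>P\<close>.  Everything rests on the fact that the hypothesis makes the
  dual projector onto the range of \<open>P + \<epsilon> S\<close> real.  The infinitesimal part of
  \<open>(P + \<epsilon> S) (Y - \<epsilon> Y S Y)\<close> is \<open>Z = (1 - Q) S Y\<close>; it satisfies \<open>Q Z = 0\<close> and \<open>Z Q = Z\<close>,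
  and it is symmetric, so it vanishes.  Consequently \<open>Q (P + \<epsilon> S) = P + \<epsilon> S\<close>: the perturbation
  of \<open>A\<^sup>m\<close> does not leave the range of \<open>A\<^sup>m\<close>, that is \<open>Q S = S\<close>.

  This information about the power passes to \<open>B\<close> itself because \<open>A + \<epsilon> B\<close> commutes with its
  \<open>m\<close>-th power.  Hence \<open>(A + \<epsilon> B) (P + \<epsilon> S)\<close> is fixed by \<open>Q\<close> too, and since \<open>A S\<close> already
  lies in the range of \<open>P\<close>, the remaining term does: \<open>Q B P = B P\<close>.

  The core-EP inverse \<open>X\<close> of \<open>A\<close> satisfies \<open>A X = Q\<close> and has its columns in the range of \<open>P\<close>,
  so that \<open>Q B X = B X\<close>.  With these identities the three core-EP equations for
  \<open>X - \<epsilon> X B X\<close> can be read off; in particular \<open>(A + \<epsilon> B) (X - \<epsilon> X B X) = Q\<close>.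
  The dual inverses involved are unique by purely algebraic arguments in a monoid with an
  involution, and the existence of \<open>X\<close> comes from the stabilisation of the rank at the index.
\<close>

section \<open>Dual matrices as a monoid with involution\<close>

lemma dual_transpose_mult: "dual_transpose (X * Y) = dual_transpose Y * dual_transpose X"
  by (simp add: dual_transpose_def times_dual_matrix_def matrix_transpose_mul)
    (simp add: transpose_def vec_eq_iff matrix_matrix_mult_def add.commute mult.commute)

text \<open>Each of two idempotents with the same range absorbs the other from the left; if both are
  symmetric, transposing one absorption law turns it into the other product.\<close>

lemma symmetric_projectors_eq:
  assumes "dual_transpose E = E" and "dual_transpose F = F" and "E * F = F" and "F * E = E"
  shows "E = F"
  by (metis assms dual_transpose_mult)

lemma dual_mp_inverse_unique:
  assumes X: "is_dual_mp_inverse C X" and Z: "is_dual_mp_inverse C Z"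
  shows "X = Z"
proof -
  have "C * X = C * Z"
    using X Z unfolding is_dual_mp_inverse_def
    by (metis symmetric_projectors_eq mult.assoc)
  moreover have "X * C = Z * C"
  proof -
    have "X * C * (Z * C) = X * C" and "Z * C * (X * C) = Z * C"
      using X Z unfolding is_dual_mp_inverse_def by (metis mult.assoc)+
    then show ?thesis
      using X Z unfolding is_dual_mp_inverse_def by (metis dual_transpose_mult)
  qed
  ultimately show ?thesis
    using X Z unfolding is_dual_mp_inverse_def by (metis mult.assoc)
qed

text \<open>Iterating \<open>X = A X\<^sup>2\<close> shows that the columns of \<open>X\<close> lie in the range of every power of
  \<open>A\<close>.\<close>

lemma outer_power_factor:
  fixes A X :: "'n::finite dual_matrix"
  assumes "A * X ^ 2 = X"
  shows "X = A ^ k * X ^ Suc k"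
proof (induction k)
  case 0
  show ?case by simp
next
  case (Suc k)
  have "A ^ Suc k * X ^ Suc (Suc k) = A ^ k * (A * X ^ 2) * X ^ k"
    by (simp add: power_commutes[symmetric] power2_eq_square mult.assoc)
  then show ?case
    using Suc assms by (simp add: mult.assoc)
qed

text \<open>For a core-EP inverse, \<open>A X\<close> and \<open>X A\<close> both act as the identity on the range of \<open>A\<^sup>m\<close>,
  where \<open>X\<close> itself lives.\<close>

lemma core_ep_absorption:
  fixes A X :: "'n::finite dual_matrix"
  assumes outer: "A * X ^ 2 = X" and core: "X * A ^ (m + 1) = A ^ m"
  shows "A * X * A ^ m = A ^ m" and "X * A * A ^ m = A ^ m"
proof -
  show "X * A * A ^ m = A ^ m"
    using core by (simp add: mult.assoc)
  have "A * X * A ^ m = A * X ^ 2 * A ^ (m + 1)"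
    using core by (metis mult.assoc power2_eq_square)
  then show "A * X * A ^ m = A ^ m"
    using outer core by simp
qed

text \<open>The projectors \<open>A X\<close> and \<open>A Z\<close> both have the range of \<open>A\<^sup>m\<close>, so they agree, and a core-EP
  inverse is recovered from its projector as \<open>X = X (A X)\<close>.\<close>

lemma dual_core_ep_inverse_unique:
  fixes A X Z :: "'n::finite dual_matrix"
  assumes X: "is_dual_core_ep_inverse A X" and Z: "is_dual_core_ep_inverse A Z"
  shows "X = Z"
proof -
  define m where "m = mat_index (std_part A)"
  have X': "dual_transpose (A * X) = A * X" "A * X ^ 2 = X" "X * A ^ (m + 1) = A ^ m"
    and Z': "dual_transpose (A * Z) = A * Z" "A * Z ^ 2 = Z" "Z * A ^ (m + 1) = A ^ m"
    using X Z by (simp_all add: is_dual_core_ep_inverse_def Let_def m_def)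
  note absX = core_ep_absorption[OF X'(2,3)] and absZ = core_ep_absorption[OF Z'(2,3)]
  have factX: "X = A ^ m * X ^ Suc m" and factZ: "Z = A ^ m * Z ^ Suc m"
    using outer_power_factor X'(2) Z'(2) by blast+
  have comm: "A * A ^ m = A ^ m * A"
    by (simp add: power_commutes)
  have "A * X * (A * Z) = A * Z"
    using absX(1) factZ comm by (metis mult.assoc)
  moreover have "A * Z * (A * X) = A * X"
    using absZ(1) factX comm by (metis mult.assoc)
  ultimately have eq: "A * X = A * Z"
    using X'(1) Z'(1) symmetric_projectors_eq by blast
  have "X * A * X = X"
    using absX(2) factX by (metis mult.assoc)
  moreover have "X * A * Z = Z"
    using absX(2) factZ by (metis mult.assoc)
  ultimately show ?thesis
    using eq by (simp add: mult.assoc)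
qed

lemma is_dual_mp_inverse_dual_mp_inverse:
  assumes "dual_mp_inverse_exists C"
  shows "is_dual_mp_inverse C (dual_mp_inverse C)"
  using assms unfolding dual_mp_inverse_exists_def dual_mp_inverse_def
  by (metis theI dual_mp_inverse_unique)

lemma dual_core_ep_inverse_eqI:
  assumes "is_dual_core_ep_inverse A X"
  shows "dual_core_ep_inverse A = X"
  using assms dual_core_ep_inverse_unique unfolding dual_core_ep_inverse_def by blast

section \<open>Real matrices, the index and the core-EP inverse\<close>

lemma matrix_mult_uminus_right: "M ** (- N) = - (M ** (N :: real ^ 'n ^ 'n))"
  by (simp add: matrix_matrix_mult_def vec_eq_iff sum_negf)

lemma mpow_commute: "A ** mpow A k = mpow A k ** A"
  by (induction k) (simp_all, metis matrix_mul_assoc)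

lemma dual_real_power: "Dual A 0 ^ k = Dual (mpow A k) 0"
proof -
  have "(M :: real ^ 'a ^ 'a) ** 0 = 0" "0 ** M = 0" for M
    by (simp_all add: matrix_matrix_mult_def vec_eq_iff)
  then show ?thesis
    by (simp add: dual_matrix_power)
qed

lemma dual_real_mult: "Dual A 0 * Dual C 0 = Dual (A ** C) (0 :: real ^ 'n::finite ^ 'n)"
  by (simp add: times_dual_matrix_def matrix_matrix_mult_def vec_eq_iff)

text \<open>Reading real matrices as dual matrices with infinitesimal part zero transfers
  uniqueness of the dual inverse to the real one.\<close>

lemma dual_core_ep_inverse_of_real:
  "is_dual_core_ep_inverse (Dual A 0) (Dual X 0) \<longleftrightarrow> is_core_ep_inverse A X"
proof -
  have "transpose 0 = (0 :: real ^ 'a ^ 'a)"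
    by (simp add: transpose_def vec_eq_iff)
  then show ?thesis
    by (simp add: is_dual_core_ep_inverse_def is_core_ep_inverse_def Let_def dual_real_mult
        dual_real_power dual_transpose_def del: power_Suc mpow.simps)
qed

lemma core_ep_inverse_eqI:
  fixes A X :: "real ^ 'n::finite ^ 'n"
  assumes "is_core_ep_inverse A X"
  shows "core_ep_inverse A = X"
  unfolding core_ep_inverse_def
  by (rule the_equality, rule assms)
    (metis assms dual_core_ep_inverse_of_real dual_core_ep_inverse_unique dual_matrix.inject)

text \<open>If multiplying by \<open>N\<close> on the right does not lower the rank, the ranges of \<open>M N\<close> and \<open>M\<close>
  agree, so every column of \<open>M\<close> can be solved for in terms of \<open>M N\<close>.\<close>

lemma rank_mult_eq_imp_factor_right:
  fixes M N :: "real ^ 'n::finite ^ 'n"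
  assumes "rank (M ** N) = rank M"
  obtains D where "M = M ** N ** D"
proof -
  have "range ((*v) (M ** N)) \<subseteq> range ((*v) M)"
    by (auto simp: matrix_vector_mul_assoc[symmetric])
  then have "range ((*v) (M ** N)) = range ((*v) M)"
    using assms
    by (intro subspace_dim_equal)
      (auto simp: rank_dim_range linear_subspace_image)
  then have "\<forall>j. \<exists>x. M ** N *v x = column j M"
    by (metis matrix_vector_mult_basis rangeE rangeI)
  then obtain d where d: "\<And>j. M ** N *v d j = column j M"
    by metis
  define D :: "real ^ 'n ^ 'n" where "D = (\<chi> i j. d j $ i)"
  have "M ** N ** D = M"
    using d by (simp add: D_def vec_eq_iff matrix_matrix_mult_def matrix_vector_mult_def column_def)
  then show ?thesis
    using that by metis
qed

lemma rank_mult_eq_imp_factor_left: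
  fixes M N :: "real ^ 'n::finite ^ 'n"
  assumes "rank (N ** M) = rank M"
  obtains E where "M = E ** (N ** M)"
proof -
  have "rank (transpose M ** transpose N) = rank (transpose M)"
    using assms by (metis matrix_transpose_mul rank_transpose)
  then obtain D where "transpose M = transpose M ** transpose N ** D"
    by (rule rank_mult_eq_imp_factor_right)
  then have "M = transpose D ** (N ** M)"
    by (metis matrix_transpose_mul transpose_transpose)
  then show ?thesis
    using that by blast
qed

text \<open>The minimum defining the index is attained, because the ranks of the powers form a
  decreasing sequence of natural numbers, which cannot be strictly decreasing.\<close>

lemma rank_mpow_mat_index:
  fixes A :: "real ^ 'n::finite ^ 'n"
  shows "rank (mpow A (mat_index A + 1)) = rank (mpow A (mat_index A))"
proof -
  have "\<exists>s. rank (mpow A (s + 1)) = rank (mpow A s)"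
  proof (rule ccontr)
    assume neq: "\<nexists>s. rank (mpow A (s + 1)) = rank (mpow A s)"
    have step: "rank (mpow A (Suc s)) < rank (mpow A s)" for s
    proof -
      have "rank (mpow A (Suc s)) \<le> rank (mpow A s)"
        by (simp add: rank_mul_le_right)
      moreover have "rank (mpow A (Suc s)) \<noteq> rank (mpow A s)"
        using neq by (metis Suc_eq_plus1)
      ultimately show ?thesis by linarith
    qed
    then show False
      using wf_less_than unfolding wf_iff_no_infinite_down_chain 
      by (auto dest: spec[of _ "\<lambda>s. rank (mpow A s)"])
  qed
  then show ?thesis
    unfolding mat_index_def by (rule LeastI_ex)
qed

text \<open>At the index, \<open>P = A\<^sup>m\<close> factors both as \<open>A P D\<close> and as \<open>E A P\<close>.  The matrix \<open>E Q\<close> inverts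
  \<open>A\<close> on the range of \<open>P\<close> by the second factorisation, and by the first it equals \<open>P D Y\<close>, so
  its columns stay in that range.\<close>

lemma core_ep_inverse_exists_from_mp_inverse:
  fixes A Y :: "real ^ 'n::finite ^ 'n"
  defines "P \<equiv> mpow A (mat_index A)"
  assumes mp: "is_mp_inverse P Y"
  obtains X D where "is_core_ep_inverse A X" and "A ** X = P ** Y" and "X = P ** D"
    and "X ** (A ** P) = P"
proof -
  have comm: "A ** P = P ** A"
    by (simp add: P_def mpow_commute)
  have rank: "rank (A ** P) = rank P"
    using rank_mpow_mat_index[of A] by (simp add: P_def)
  obtain D where D: "P = A ** P ** D"
    using rank comm by (metis rank_mult_eq_imp_factor_right)
  obtain E where E: "P = E ** (A ** P)"
    using rank by (rule rank_mult_eq_imp_factor_left)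
  have PYP: "P ** Y ** P = P" and sym: "transpose (P ** Y) = P ** Y"
    using mp by (simp_all add: is_mp_inverse_def)
  define X where "X = P ** D ** Y"
  have X_left: "X = E ** (P ** Y)"
    unfolding X_def using D E by (metis matrix_mul_assoc)
  have AX: "A ** X = P ** Y"
    unfolding X_def using D by (metis matrix_mul_assoc)
  have "A ** mpow X 2 = X"
  proof -
    have "A ** mpow X 2 = A ** X ** X"
      by (simp add: numeral_2_eq_2 matrix_mul_assoc)
    also have "\<dots> = P ** Y ** X"
      by (simp add: AX)
    also have "\<dots> = X"
      unfolding X_def using PYP by (simp add: matrix_mul_assoc)
    finally show ?thesis .
  qed
  moreover have XAP: "X ** (A ** P) = P"
    unfolding X_left using E PYP comm by (metis matrix_mul_assoc)
  ultimately have "is_core_ep_inverse A X"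
    using AX sym by (simp add: is_core_ep_inverse_def P_def)
  then show ?thesis
    using that[of X "D ** Y"] AX XAP by (simp add: X_def matrix_mul_assoc)
qed

section \<open>The dual inverses\<close>

text \<open>The infinitesimal part \<open>Z\<close> of the projector \<open>C C\<^sup>\<dagger>\<close> is symmetric, absorbs \<open>Q\<close> on the right
  and is annihilated by \<open>Q\<close> on the left; these are compatible only if \<open>Z = 0\<close>.\<close>

lemma dual_range_projector_real:
  fixes P S Y :: "real ^ 'n::finite ^ 'n"
  assumes mp: "is_dual_mp_inverse (Dual P S) (Dual Y (- (Y ** S ** Y)))"
  shows "is_mp_inverse P Y"
    and "Dual P S * Dual Y (- (Y ** S ** Y)) = Dual (P ** Y) 0"
    and "P ** Y ** S = S"
proof -
  show real: "is_mp_inverse P Y"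
    using mp by (simp add: is_mp_inverse_def is_dual_mp_inverse_def dual_transpose_def
        times_dual_matrix_def)
  define Q where "Q = P ** Y"
  have Q: "Q ** Q = Q" "Y ** Q = Y" "transpose Q = Q"
    using real by (simp_all add: is_mp_inverse_def Q_def matrix_mul_assoc)
  define Z where "Z = S ** Y - Q ** S ** Y"
  have proj: "Dual P S * Dual Y (- (Y ** S ** Y)) = Dual Q Z"
    by (simp add: times_dual_matrix_def Q_def Z_def matrix_mult_uminus_right matrix_mul_assoc)
  have decomp: "S ** Y = Z + Q ** S ** Y"
    by (simp add: Z_def)
  have "Q ** S ** Y = Q ** Z + Q ** S ** Y"
    using arg_cong[OF decomp, of "\<lambda>M. Q ** M"] Q(1)
    by (simp add: matrix_add_ldistrib matrix_mul_assoc)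
  then have QZ: "Q ** Z = 0"
    by simp
  have "S ** Y = Z ** Q + Q ** S ** Y"
    using arg_cong[OF decomp, of "\<lambda>M. M ** Q"] Q(2)
    by (simp add: matrix_add_rdistrib' matrix_mul_assoc[symmetric])
  then have ZQ: "Z ** Q = Z"
    using decomp by (metis add_right_cancel)
  have "transpose Z = Z"
    using mp unfolding is_dual_mp_inverse_def proj by (simp add: dual_transpose_def)
  then have "Z = Q ** Z"
    using ZQ Q(3) by (metis matrix_transpose_mul)
  then have "Z = 0"
    using QZ by simp
  then show proj0: "Dual P S * Dual Y (- (Y ** S ** Y)) = Dual (P ** Y) 0"
    using proj by (simp add: Q_def)
  have "Dual (P ** Y) 0 * Dual P S = Dual P S"
    using mp unfolding is_dual_mp_inverse_def proj0 by blast
  then show "P ** Y ** S = S"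
    by (simp add: times_dual_matrix_def matrix_matrix_mult_def vec_eq_iff)
qed

text \<open>Comparing the infinitesimal parts of \<open>(A + \<epsilon> B) (P + \<epsilon> S) = (P + \<epsilon> S) (A + \<epsilon> B)\<close> expresses
  \<open>A S + B P\<close> through matrices whose columns lie in the range of \<open>P\<close>.\<close>

lemma range_invariant_of_commuting_perturbation:
  fixes A B P S Q :: "real ^ 'n::finite ^ 'n"
  assumes real: "A ** P = P ** A"
    and inf: "A ** S + B ** P = P ** B + S ** A"
    and Q: "Q = P ** Y" "Q ** P = P" "Q ** S = S"
  shows "Q ** (B ** P) = B ** P"
proof -
  have "Q ** (A ** S + B ** P) = A ** S + B ** P"
    unfolding inf using Q by (simp add: matrix_add_ldistrib matrix_mul_assoc)
  moreover have "Q ** (A ** S) = A ** S"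
    \<comment> \<open>\<open>S = P (Y S)\<close>, and \<open>A P = P A\<close> moves \<open>P\<close> to the front, where \<open>Q\<close> fixes it.\<close>
    using real Q by (metis matrix_mul_assoc)
  ultimately show ?thesis
    by (simp add: matrix_add_ldistrib)
qed

theorem theorem5p3:
  fixes A B S :: "real ^ 'n ^ 'n" and m :: nat
  assumes "mat_index A = m"
    and "S = (\<Sum>i = 1..m. mpow A (m - i) ** B ** mpow A (i - 1))"
    and "dual_mp_inverse_exists (Dual A B ^ m)"
    and "dual_mp_inverse (Dual A B ^ m) =
           Dual (mp_inverse (mpow A m))
                (- (mp_inverse (mpow A m) ** S ** mp_inverse (mpow A m)))"
  shows "dual_core_ep_inverse_exists (Dual A B) \<and>
         dual_core_ep_inverse (Dual A B) =
           Dual (core_ep_inverse A)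
                (- (core_ep_inverse A ** B ** core_ep_inverse A))"
proof -
  define P where "P = mpow A m"
  define Y where "Y = mp_inverse P"
  define Q where "Q = P ** Y"
  have power: "Dual A B ^ m = Dual P S"
    by (simp add: dual_matrix_power P_def assms(2))
  have "is_dual_mp_inverse (Dual P S) (Dual Y (- (Y ** S ** Y)))"
    using is_dual_mp_inverse_dual_mp_inverse[OF assms(3)] assms(4)
    by (simp add: power P_def Y_def)
  note proj = dual_range_projector_real[OF this]
  have QP: "Q ** P = P" and QS: "Q ** S = S" and symQ: "transpose Q = Q"
    using proj by (simp_all add: is_mp_inverse_def Q_def)
  have "Dual A B * Dual P S = Dual P S * Dual A B"
    by (metis power power_commutes)
  then have "A ** P = P ** A" and "A ** S + B ** P = P ** B + S ** A"
    by (simp_all add: times_dual_matrix_def)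
  then have QBP: "Q ** (B ** P) = B ** P"
    using Q_def QP QS by (rule range_invariant_of_commuting_perturbation)
  have "is_mp_inverse (mpow A (mat_index A)) Y"
    using proj(1) by (simp add: P_def assms(1))
  then obtain X D where X: "is_core_ep_inverse A X" and AX: "A ** X = Q" and XD: "X = P ** D"
    and XAP: "X ** (A ** P) = P"
    by (rule core_ep_inverse_exists_from_mp_inverse) (simp add: Q_def P_def assms(1))
  have QX: "Q ** X = X"
    by (simp add: XD matrix_mul_assoc QP)
  have QBX: "Q ** B ** X = B ** X"
    using QBP by (simp add: XD matrix_mul_assoc)
  have XAS: "X ** (A ** S) = S"
    using XAP QS Q_def by (metis matrix_mul_assoc)
  define W where "W = Dual X (- (X ** B ** X))"
  have real_proj: "Dual A B * W = Dual Q 0"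
    by (simp add: W_def times_dual_matrix_def matrix_mult_uminus_right matrix_mul_assoc AX QBX)
  have "is_dual_core_ep_inverse (Dual A B) W"
  proof -
    have "dual_transpose (Dual A B * W) = Dual A B * W"
      by (simp add: real_proj dual_transpose_def symQ) (simp add: transpose_def vec_eq_iff)
    moreover have "Dual A B * W ^ 2 = W"
    proof -
      have "Dual A B * W ^ 2 = Dual Q 0 * W"
        by (simp add: power2_eq_square mult.assoc[symmetric] real_proj)
      also have "\<dots> = Dual (Q ** X) (- (Q ** X ** B ** X))"
        by (simp add: W_def times_dual_matrix_def matrix_mult_uminus_right matrix_mul_assoc)
      finally show ?thesis
        by (simp add: QX W_def)
    qed
    moreover have "W * Dual A B ^ (m + 1) = Dual A B ^ m"
    proof -
      have "W * Dual A B ^ (m + 1) = W * (Dual A B * Dual P S)"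
        by (simp add: power)
      also have "\<dots> = Dual (X ** (A ** P))
          (X ** (A ** S) + X ** (B ** P) + - (X ** B ** X) ** (A ** P))"
        by (simp add: W_def times_dual_matrix_def matrix_add_ldistrib)
      also have "- (X ** B ** X) ** (A ** P) = - (X ** (B ** P))"
      proof -
        have "X ** B ** X ** (A ** P) = X ** (B ** P)"
          using XAP by (simp add: matrix_mul_assoc[symmetric])
        then show ?thesis
          by (simp add: matrix_matrix_mult_def vec_eq_iff sum_negf)
      qed
      finally show ?thesis
        by (simp add: XAP XAS power)
    qed
    ultimately show ?thesis
      by (simp add: is_dual_core_ep_inverse_def assms(1))
  qed
  moreover have "core_ep_inverse A = X"
    using X by (rule core_ep_inverse_eqI)
  ultimately show ?thesis
    using dual_core_ep_inverse_eqI unfolding dual_core_ep_inverse_exists_def W_def by blast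
qed

end
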